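(* Assume that $f_1,\dots,f_n:\mathbb{R}\to\mathbb{R}$ are $L$-smooth (not necessarily convex). Let $(\boldsymbol{w}_t)$ be generated by the Stochastic Frank-Wolfe algorithm (defined in the context), and for $t\ge 1$ let $$g_t=\max_{\boldsymbol{s}\in\mathcal{C}}\langle\nabla f(\boldsymbol{X}\boldsymbol{w}_{t-1}),\boldsymbol{X}(\boldsymbol{w}_{t-1}-\boldsymbol{s})\rangle$$ be the Frank-Wolfe gap. Then, almost surely, $$\liminf_{t\to\infty}\ \mathbb{E}_t\, g_t = 0.$$
   Context: Setting: $n,d\ge 1$ are integers, $\mathcal{C}\subset\mathbb{R}^d$ is a nonempty compact convex set, and $\boldsymbol{X}\in\mathbb{R}^{n\times d}$ is a matrix with rows $\boldsymbol{x}_1^\top,\dots,\boldsymbol{x}_n^\top$. Given functions $f_i:\mathbb{R}\to\mathbb{R}$, define $f:\mathbb{R}^n\to\mathbb{R}$ by $f(\boldsymbol{\theta})=\frac1n\sum_{i=1}^n f_i(\boldsymbol{\theta}_i)$. A function $h:\mathbb{R}\to\mathbb{R}$ is $L$-smooth if it is differentiable and $|h'(z)-h'(z')|\le L|z-z'|$ for all $z,z'$. $\mathrm{LMO}(\boldsymbol{u})$ denotes an (arbitrarily selected) element of $\arg\min_{\boldsymbol{s}\in\mathcal{C}}\langle\boldsymbol{s},\boldsymbol{u}\rangle$. Stochastic Frank-Wolfe algorithm: fix $\boldsymbol{w}_0\in\mathcal{C}$, $\boldsymbol{\alpha}_0\in\mathbb{R}^n$, $\boldsymbol{r}_0=\boldsymbol{X}^\top\boldsymbol{\alpha}_0$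 (deterministic). For $t=1,2,\dots$: sample $i\in\{1,\dots,n\}$ uniformly at random, independently of the past; set $\boldsymbol{\alpha}_t^{(i)}=\frac1n f_i'(\boldsymbol{x}_i^\top\boldsymbol{w}_{t-1})$ and $\boldsymbol{\alpha}_t^{(j)}=\boldsymbol{\alpha}_{t-1}^{(j)}$ for $j\ne i$; set $\boldsymbol{r}_t=\boldsymbol{r}_{t-1}+(\boldsymbol{\alpha}_t^{(i)}-\boldsymbol{\alpha}_{t-1}^{(i)})\boldsymbol{x}_i$; set $\boldsymbol{s}_t=\mathrm{LMO}(\boldsymbol{r}_t)$; set $\boldsymbol{w}_t=\boldsymbol{w}_{t-1}+\frac{2}{t+2}(\boldsymbol{s}_t-\boldsymbol{w}_{t-1})$. Here $\boldsymbol{\alpha}^{(i)}$ is the $i$-th coordinate of $\boldsymbol{\alpha}$. $\mathbb{E}_t$ is the conditional expectation with respect to the random index sampled at iteration $t$, conditioned on all randomness before that sampling (the indices sampled at iterations $1,\dots,t-1$). *)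

theory Defs
  imports "HOL-Probability.Probability"
begin

definition L_smooth :: "real \<Rightarrow> (real \<Rightarrow> real) \<Rightarrow> bool" where
  "L_smooth L h \<longleftrightarrow>
     (\<forall>z. h differentiable (at z)) \<and>
     (\<forall>z z'. \<bar>deriv h z - deriv h z'\<bar> \<le> L * \<bar>z - z'\<bar>)"

definition gradient :: "('v::real_inner \<Rightarrow> real) \<Rightarrow> 'v \<Rightarrow> 'v" where
  "gradient F x = (THE D. GDERIV F x :> D)"

definition objective :: "('n::finite \<Rightarrow> real \<Rightarrow> real) \<Rightarrow> real ^ 'n \<Rightarrow> real" where
  "objective f \<theta> = (1 / real CARD('n)) * (\<Sum>i\<in>UNIV. f i (\<theta> $ i))"

text \<open>The selection is an arbitrary function, not assumed measurable or continuous.\<close>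

definition is_LMO :: "(real ^ 'd) set \<Rightarrow> (real ^ 'd \<Rightarrow> real ^ 'd) \<Rightarrow> bool" where
  "is_LMO C LMO \<longleftrightarrow> (\<forall>u. is_arg_min (\<lambda>s. s \<bullet> u) (\<lambda>s. s \<in> C) (LMO u))"

text \<open>
  The state after \<open>t\<close> iterations is the triple of the iterate \<open>w\<close>, the table \<open>\<alpha>\<close> and the
  vector \<open>r\<close>. Iteration \<open>t \<ge> 1\<close> uses the index \<open>idx t\<close>; the value \<open>idx 0\<close> is never used.
  The rows of the data matrix are \<open>X $ i\<close>.
\<close>

primrec sfw_state ::
  "real ^ 'd ^ 'n \<Rightarrow> ('n::finite \<Rightarrow> real \<Rightarrow> real) \<Rightarrow> (real ^ 'd \<Rightarrow> real ^ 'd) \<Rightarrow>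
   real ^ 'd \<Rightarrow> real ^ 'n \<Rightarrow> (nat \<Rightarrow> 'n) \<Rightarrow> nat \<Rightarrow> (real ^ 'd) \<times> (real ^ 'n) \<times> (real ^ 'd)" where
  "sfw_state X f LMO w0 \<alpha>0 idx 0 = (w0, \<alpha>0, transpose X *v \<alpha>0)"
| "sfw_state X f LMO w0 \<alpha>0 idx (Suc t) =
     (case sfw_state X f LMO w0 \<alpha>0 idx t of (w, \<alpha>, r) \<Rightarrow>
        let i = idx (Suc t);
            \<alpha>' = (\<chi> j. if j = i then (1 / real CARD('n)) * deriv (f i) ((X $ i) \<bullet> w) else \<alpha> $ j);
            r' = r + (\<alpha>' $ i - \<alpha> $ i) *\<^sub>R (X $ i);
            s = LMO r';
            w' = w + (2 / (real (Suc t) + 2)) *\<^sub>R (s - w)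
        in (w', \<alpha>', r'))"

definition sfw_iterate ::
  "real ^ 'd ^ 'n \<Rightarrow> ('n::finite \<Rightarrow> real \<Rightarrow> real) \<Rightarrow> (real ^ 'd \<Rightarrow> real ^ 'd) \<Rightarrow>
   real ^ 'd \<Rightarrow> real ^ 'n \<Rightarrow> (nat \<Rightarrow> 'n) \<Rightarrow> nat \<Rightarrow> real ^ 'd" where
  "sfw_iterate X f LMO w0 \<alpha>0 idx t = fst (sfw_state X f LMO w0 \<alpha>0 idx t)"

text \<open>For nonempty compact \<open>C\<close> the supremum is attained, i.e. it is a maximum.\<close>

definition fw_gap ::
  "(real ^ 'd) set \<Rightarrow> real ^ 'd ^ 'n \<Rightarrow> ('n::finite \<Rightarrow> real \<Rightarrow> real) \<Rightarrow> real ^ 'd \<Rightarrow> real" where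
  "fw_gap C X f w = (SUP s\<in>C. gradient (objective f) (X *v w) \<bullet> (X *v (w - s)))"

text \<open>The indices sampled at iterations \<open>1, \<dots>, t - 1\<close>, as one random element.\<close>

definition past_space :: "nat \<Rightarrow> (nat \<Rightarrow> 'n) measure" where
  "past_space t = PiM {1..<t} (\<lambda>_. count_space UNIV)"

definition past_indices :: "(nat \<Rightarrow> 'a \<Rightarrow> 'n) \<Rightarrow> nat \<Rightarrow> 'a \<Rightarrow> (nat \<Rightarrow> 'n)" where
  "past_indices I t \<omega> = restrict (\<lambda>k. I k \<omega>) {1..<t}"

definition past_algebra :: "'a measure \<Rightarrow> (nat \<Rightarrow> 'a \<Rightarrow> 'n) \<Rightarrow> nat \<Rightarrow> 'a measure" where
  "past_algebra M I t = vimage_algebra (space M) (past_indices I t) (past_space t)"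

definition uniform_sampling :: "'a measure \<Rightarrow> (nat \<Rightarrow> 'a \<Rightarrow> 'n::finite) \<Rightarrow> bool" where
  "uniform_sampling M I \<longleftrightarrow>
     (\<forall>t\<ge>1. I t \<in> measurable M (count_space UNIV) \<and>
       distr M (count_space UNIV) (I t) = uniform_count_measure UNIV \<and>
       prob_space.indep_set M
         (sets (vimage_algebra (space M) (I t) (count_space UNIV)))
         (sets (past_algebra M I t)))"

end

theory Submission imports Defs begin

text \<open>
  The Frank--Wolfe gap at iteration \<open>t\<close> is a function of the indices sampled before \<open>t\<close>, so its
  conditional expectation is almost surely the gap itself (\<open>real_cond_exp_fun_past\<close>).
  It remains to show that the gap, which is nonnegative, has lower limit 0 along almost
  every trajectory. Write \<open>\<eta>\<^sub>t = 2 / (t + 2)\<close>.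

  One step of the algorithm would decrease the objective by at least \<open>\<eta>\<^sub>t\<close> times the gap, up to a
  curvature term of order \<open>\<eta>\<^sub>t\<^sup>2\<close>, if the oracle were called with the true gradient. It is called
  with \<open>X\<^sup>T \<alpha>\<close>, where the table \<open>\<alpha>\<close> holds outdated partial derivatives; this costs at most
  a constant multiple of \<open>\<eta>\<^sub>t\<close> times the \<open>\<ell>\<^sub>1\<close>-error of the table (\<open>objective_descent\<close>).
  The objective is bounded below on the compact feasible set, and \<open>\<Sum> \<eta>\<^sub>t\<^sup>2 < \<infinity>\<close>. Hence, on every trajectory for which the table
  errors weighted by \<open>\<eta>\<^sub>t\<close> are summable, the gaps weighted by \<open>\<eta>\<^sub>t\<close> are summable as well; since
  \<open>\<Sum> \<eta>\<^sub>t = \<infinity>\<close>, the gaps cannot stay away from 0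
  (\<open>liminf_gap_of_summable_table_error\<close>).

  Randomness is needed only to control the table. An entry has error 0 right after its index is
  sampled; if its index is missed, which has probability \<open>1 - 1/n\<close> independently of the past, the
  error is kept; and the subsequent move of the iterate changes it by \<open>O(\<eta>\<^sub>t)\<close>. So the expected
  error \<open>u\<^sub>t\<close> satisfies \<open>u\<^sub>t\<^sub>+\<^sub>1 \<le> (1 - 1/n) u\<^sub>t + c \<eta>\<^sub>t\<^sub>+\<^sub>1\<close> (\<open>expectation_staleness_Suc\<close>). Multiplying by the
  decreasing \<open>\<eta>\<^sub>t\<close> gives a contraction for \<open>\<eta>\<^sub>t u\<^sub>t\<close> with the summable perturbation \<open>c \<eta>\<^sub>t\<^sub>+\<^sub>1\<^sup>2\<close>, whence
  \<open>\<Sum> \<eta>\<^sub>t u\<^sub>t < \<infinity>\<close>, and a nonnegative series with finite expectation converges almost surely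
  (\<open>AE_summable_table_error\<close>).
\<close>

section \<open>Real sequences\<close>

text \<open>
  Summing the recursion bounds a partial sum \<open>S\<close> of \<open>a\<close> by \<open>a 0 + \<rho> S + \<Sum> b\<close>, which can be
  solved for \<open>S\<close>.
\<close>

lemma summable_of_contraction:
  fixes a b :: "nat \<Rightarrow> real"
  assumes "\<And>t. 0 \<le> a t" and "\<And>t. 0 \<le> b t" and "summable b"
    and "\<rho> < 1" and rec: "\<And>t. a (Suc t) \<le> \<rho> * a t + b t"
  shows "summable a"
proof -
  have "(\<Sum>t<T. a t) \<le> (a 0 + suminf b) / (1 - \<rho>)" for T
  proof -
    have "(\<Sum>t<T. a t) \<le> (\<Sum>t<Suc T. a t)"
      using assms(1) by simp
    also have "\<dots> = a 0 + (\<Sum>t<T. a (Suc t))"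
      by (simp only: sum.lessThan_Suc_shift)
    also have "\<dots> \<le> a 0 + (\<Sum>t<T. \<rho> * a t + b t)"
      by (intro add_left_mono sum_mono rec)
    also have "\<dots> = a 0 + \<rho> * (\<Sum>t<T. a t) + (\<Sum>t<T. b t)"
      by (simp add: sum.distrib sum_distrib_left)
    also have "\<dots> \<le> a 0 + \<rho> * (\<Sum>t<T. a t) + suminf b"
      using assms by (intro add_left_mono sum_le_suminf) auto
    finally show ?thesis
      using \<open>\<rho> < 1\<close> by (simp add: field_simps)
  qed
  then show ?thesis
    using assms(1) by (intro summableI_nonneg_bounded) auto
qed

text \<open>
  Telescoping: the total decrease that \<open>b\<close> forces on \<open>a\<close> is limited by the lower bound of \<open>a\<close>
  and by what \<open>c\<close> gives back.
\<close>

lemma summable_of_descent: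
  fixes a b c :: "nat \<Rightarrow> real"
  assumes "\<And>t. m \<le> a t" and "\<And>t. 0 \<le> b t" and "\<And>t. 0 \<le> c t" and "summable c"
    and descent: "\<And>t. a (Suc t) \<le> a t - b t + c t"
  shows "summable b"
proof -
  have partial_sum: "(\<Sum>t<T. b t) \<le> a 0 - a T + (\<Sum>t<T. c t)" for T
  proof (induction T)
    case (Suc T)
    then show ?case using descent[of T] by simp
  qed simp
  have "(\<Sum>t<T. b t) \<le> a 0 - m + suminf c" for T
  proof -
    have "(\<Sum>t<T. c t) \<le> suminf c"
      using assms by (intro sum_le_suminf) auto
    then show ?thesis
      using partial_sum[of T] assms(1)[of T] by linarith
  qed
  then show ?thesis
    using assms(2) by (intro summableI_nonneg_bounded) auto
qed

text \<open>
  If \<open>a\<close> were eventually above some \<open>c > 0\<close>, then \<open>c \<eta>\<close> would be dominated by the summable \<open>\<eta> a\<close>.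
\<close>

lemma liminf_eq_0_of_summable_weighted:
  fixes a \<eta> :: "nat \<Rightarrow> real"
  assumes "\<And>t. 0 \<le> a t" and "\<And>t. 0 \<le> \<eta> t" and "\<not> summable \<eta>"
    and "summable (\<lambda>t. \<eta> t * a t)"
  shows "liminf (\<lambda>t. ereal (a t)) = 0"
proof (rule antisym)
  show "liminf (\<lambda>t. ereal (a t)) \<le> 0"
  proof (rule ccontr)
    assume "\<not> ?thesis"
    then obtain c :: real where c: "0 < ereal c" "ereal c < liminf (\<lambda>t. ereal (a t))"
      by (meson ereal_dense2 not_le)
    then have "eventually (\<lambda>t. ereal c < ereal (a t)) sequentially"
      by (auto dest: less_LiminfD)
    then have "eventually (\<lambda>t. norm (c * \<eta> t) \<le> \<eta> t * a t) sequentially"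
    proof eventually_elim
      case (elim t)
      then show ?case
        using c assms(2)[of t] by (simp add: abs_mult mult.commute[of c] mult_left_mono)
    qed
    then have "summable (\<lambda>t. c * \<eta> t)"
      using assms(4) by (rule summable_comparison_test_ev)
    then show False
      using c \<open>\<not> summable \<eta>\<close> by simp
  qed
  show "0 \<le> liminf (\<lambda>t. ereal (a t))"
    using assms(1) by (intro Liminf_bounded) simp
qed

definition step_size :: "nat \<Rightarrow> real" where
  "step_size t = 2 / (real t + 2)"

lemma step_size_nonneg: "0 \<le> step_size t"
  and step_size_le_1: "step_size t \<le> 1"
  and step_size_antimono: "step_size (Suc t) \<le> step_size t"
  by (simp_all add: step_size_def frac_le)

lemma summable_step_size_square: "summable (\<lambda>t. (step_size t)\<^sup>2)"
proof -
  have "summable (\<lambda>t. 4 * inverse (real (t + 2) ^ 2))"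
    using inverse_power_summable[of 2, where 'a = real]
    by (intro summable_mult) (subst summable_iff_shift, simp)
  then show ?thesis
    by (simp add: step_size_def power_divide divide_inverse power_inverse add.commute[of 2])
qed

lemma not_summable_step_size: "\<not> summable (\<lambda>t. step_size (Suc t))"
proof
  have "inverse (real (t + 3)) = (1/2) * step_size (Suc t)" for t
    by (simp add: step_size_def inverse_eq_divide)
  moreover assume "summable (\<lambda>t. step_size (Suc t))"
  then have "summable (\<lambda>t. (1/2) * step_size (Suc t))"
    by (rule summable_mult)
  ultimately have "summable (\<lambda>t. inverse (real (t + 3)))"
    by presburger
  then have "summable (\<lambda>n. inverse (real n))"
    by (rule summable_iff_shift[THEN iffD1])
  then show False
    using not_summable_harmonic by blast
qed

lemma mult_le_abs_mult: "\<bar>y\<bar> \<le> b \<Longrightarrow> x * y \<le> \<bar>x\<bar> * b" for x y b :: real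
proof -
  assume "\<bar>y\<bar> \<le> b"
  then have "\<bar>x\<bar> * \<bar>y\<bar> \<le> \<bar>x\<bar> * b"
    by (rule mult_left_mono) simp
  then show "x * y \<le> \<bar>x\<bar> * b"
    using abs_ge_self[of "x * y"] by (simp add: abs_mult)
qed

section \<open>Smooth functions and the gradient of the objective\<close>

lemma L_smooth_nonneg:
  assumes "L_smooth L h"
  shows "0 \<le> L"
proof -
  have "\<bar>deriv h 1 - deriv h 0\<bar> \<le> L * \<bar>1 - 0\<bar>"
    using assms unfolding L_smooth_def by blast
  then show ?thesis
    by simp
qed

lemma L_smooth_DERIV: "L_smooth L h \<Longrightarrow> DERIV h z :> deriv h z"
  by (simp add: L_smooth_def DERIV_deriv_iff_real_differentiable)

text \<open>
  The constant \<open>L\<close> in front of the square is twice the optimal one. The mean value theorem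
  gives it at once, and the size of the constant does not affect summability.
\<close>

lemma L_smooth_upper_bound:
  assumes "L_smooth L h"
  shows "h b \<le> h a + deriv h a * (b - a) + L * (b - a)\<^sup>2"
proof -
  note D = L_smooth_DERIV[OF assms]
  \<comment> \<open>The order of \<open>a\<close> and \<open>b\<close> is arbitrary, so the mean value theorem is needed in both directions.\<close>
  obtain z where z: "\<bar>z - a\<bar> \<le> \<bar>b - a\<bar>" "h b - h a = (b - a) * deriv h z"
  proof (cases a b rule: linorder_cases)
    case less
    then show ?thesis using MVT2[OF less, of h "deriv h"] D that by force
  next
    case equal
    then show ?thesis using that[of a] by simp
  next
    case greater
    then obtain z where "b < z" "z < a" "h a - h b = (a - b) * deriv h z"
      using MVT2[OF greater, of h "deriv h"] D by blast
    then show ?thesis using that[of z] by (simp add: algebra_simps)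
  qed
  have "(b - a) * (deriv h z - deriv h a) \<le> \<bar>b - a\<bar> * \<bar>deriv h z - deriv h a\<bar>"
    by (metis abs_ge_self abs_mult)
  also have "\<dots> \<le> \<bar>b - a\<bar> * (L * \<bar>z - a\<bar>)"
    using assms by (intro mult_left_mono) (auto simp: L_smooth_def)
  also have "\<dots> \<le> \<bar>b - a\<bar> * (L * \<bar>b - a\<bar>)"
    using z L_smooth_nonneg[OF assms] by (intro mult_left_mono) auto
  also have "\<dots> = L * (b - a)\<^sup>2"
    by (simp add: power2_eq_square mult.left_commute)
  finally show ?thesis
    using z(2) by (simp add: algebra_simps)
qed

lemma gradient_objective:
  fixes f :: "'n::finite \<Rightarrow> real \<Rightarrow> real"
  assumes "\<And>i. L_smooth L (f i)"
  shows "gradient (objective f) \<theta> = (\<chi> i. (1 / real CARD('n)) * deriv (f i) (\<theta> $ i))"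
    (is "_ = ?D")
proof -
  have "((\<lambda>\<theta>. f i (\<theta> $ i)) has_derivative (\<lambda>h. deriv (f i) (\<theta> $ i) * (h $ i))) (at \<theta>)" for i
    using has_derivative_compose[OF bounded_linear_imp_has_derivative[OF bounded_linear_vec_nth]
        L_smooth_DERIV[OF assms, unfolded has_field_derivative_def]]
    by blast
  then have "(objective f has_derivative
      (\<lambda>h. (1 / real CARD('n)) * (\<Sum>i\<in>UNIV. deriv (f i) (\<theta> $ i) * (h $ i)))) (at \<theta>)"
    unfolding objective_def[abs_def]
    by (intro has_derivative_mult_right has_derivative_sum)
  then have D: "GDERIV (objective f) \<theta> :> ?D"
    by (simp add: gderiv_def inner_vec_def sum_distrib_left mult_ac)
  have unique: "D' = ?D" if "GDERIV (objective f) \<theta> :> D'" for D'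
    using has_derivative_unique[OF that[unfolded gderiv_def] D[unfolded gderiv_def]]
    by (metis vector_eq_ldot)
  show ?thesis
    unfolding gradient_def by (rule the_equality, rule D, rule unique)
qed

section \<open>The deterministic part: one trajectory\<close>

locale frank_wolfe =
  fixes C :: "(real ^ 'd) set"
    and X :: "real ^ 'd ^ 'n"
    and f :: "'n::finite \<Rightarrow> real \<Rightarrow> real"
    and L :: real
    and LMO :: "real ^ 'd \<Rightarrow> real ^ 'd"
    and w0 :: "real ^ 'd"
    and \<alpha>0 :: "real ^ 'n"
  assumes compact_C: "compact C" and convex_C: "convex C"
    and smooth: "\<And>i. L_smooth L (f i)"
    and LMO: "is_LMO C LMO"
    and w0_in_C: "w0 \<in> C"
begin

text \<open>The \<open>i\<close>-th coordinate of the gradient of the objective at \<open>X w\<close>.\<close>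

definition partial_grad :: "real ^ 'd \<Rightarrow> 'n \<Rightarrow> real" where
  "partial_grad w i = (1 / real CARD('n)) * deriv (f i) (X $ i \<bullet> w)"

abbreviation iter :: "(nat \<Rightarrow> 'n) \<Rightarrow> nat \<Rightarrow> real ^ 'd" where
  "iter \<equiv> sfw_iterate X f LMO w0 \<alpha>0"

definition grad_table :: "(nat \<Rightarrow> 'n) \<Rightarrow> nat \<Rightarrow> real ^ 'n" where
  "grad_table idx t = fst (snd (sfw_state X f LMO w0 \<alpha>0 idx t))"

text \<open>
  The error of entry \<open>i\<close> of the table after iteration \<open>t\<close>, measured at the iterate that iteration
  \<open>t\<close> has just produced. It depends only on the indices sampled up to \<open>t\<close>, hence is independent of
  the index of iteration \<open>t + 1\<close>, which decides whether the entry is refreshed.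
\<close>

definition staleness :: "(nat \<Rightarrow> 'n) \<Rightarrow> nat \<Rightarrow> 'n \<Rightarrow> real" where
  "staleness idx t i = \<bar>partial_grad (iter idx t) i - grad_table idx t $ i\<bar>"

lemma staleness_nonneg: "0 \<le> staleness idx t i"
  by (simp add: staleness_def)

text \<open>A common bound for the extent of \<open>C\<close> in the directions of the rows of \<open>X\<close>.\<close>

definition width :: real where
  "width = diameter C * (\<Sum>i\<in>UNIV. norm (X $ i))"

lemma width_nonneg: "0 \<le> width"
  unfolding width_def
  by (intro mult_nonneg_nonneg sum_nonneg diameter_ge_0 compact_imp_bounded compact_C) auto

lemma inner_diff_le_width:
  assumes "s \<in> C" "s' \<in> C"
  shows "\<bar>X $ i \<bullet> (s - s')\<bar> \<le> width"
proof -
  have "\<bar>X $ i \<bullet> (s - s')\<bar> \<le> norm (X $ i) * norm (s - s')"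
    by (rule Cauchy_Schwarz_ineq2)
  also have "\<dots> \<le> (\<Sum>i\<in>UNIV. norm (X $ i)) * diameter C"
    using diameter_bounded_bound[OF compact_imp_bounded[OF compact_C] assms]
    by (intro mult_mono member_le_sum sum_nonneg) (auto simp: dist_norm)
  finally show ?thesis by (simp add: width_def mult.commute)
qed

lemma LMO_in_C: "LMO u \<in> C"
  and LMO_le: "s \<in> C \<Longrightarrow> LMO u \<bullet> u \<le> s \<bullet> u"
  using LMO by (auto simp: is_LMO_def is_arg_min_linorder)

text \<open>The factor \<open>1/n\<close> is estimated by 1.\<close>

lemma partial_grad_lipschitz:
  "\<bar>partial_grad w i - partial_grad w' i\<bar> \<le> L * \<bar>X $ i \<bullet> (w - w')\<bar>"
proof -
  have "\<bar>partial_grad w i - partial_grad w' i\<bar>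
      = (1 / real CARD('n)) * \<bar>deriv (f i) (X $ i \<bullet> w) - deriv (f i) (X $ i \<bullet> w')\<bar>"
    by (simp add: partial_grad_def abs_mult flip: right_diff_distrib diff_divide_distrib)
  also have "\<dots> \<le> 1 * \<bar>deriv (f i) (X $ i \<bullet> w) - deriv (f i) (X $ i \<bullet> w')\<bar>"
    by (intro mult_right_mono) (auto simp: Suc_leI)
  also have "\<dots> \<le> L * \<bar>X $ i \<bullet> (w - w')\<bar>"
    using smooth[of i] by (simp add: L_smooth_def inner_diff_right)
  finally show ?thesis .
qed

lemma iter_0: "iter idx 0 = w0"
  by (simp add: sfw_iterate_def)

lemma grad_table_Suc:
  "grad_table idx (Suc t) $ j =
    (if j = idx (Suc t) then partial_grad (iter idx t) j else grad_table idx t $ j)"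
  by (simp add: grad_table_def sfw_iterate_def partial_grad_def Let_def split: prod.split)

text \<open>
  The incrementally updated \<open>r\<close> always equals \<open>X\<^sup>T \<alpha>\<close>, because a change of the \<open>i\<close>-th table entry
  changes \<open>X\<^sup>T \<alpha>\<close> by a multiple of the \<open>i\<close>-th row. So the oracle sees nothing but the table.
\<close>

lemma residual_eq:
  "snd (snd (sfw_state X f LMO w0 \<alpha>0 idx t)) = transpose X *v grad_table idx t"
proof (induction t)
  case (Suc t)
  let ?i = "idx (Suc t)"
  have "grad_table idx (Suc t) = grad_table idx t +
      (grad_table idx (Suc t) $ ?i - grad_table idx t $ ?i) *\<^sub>R axis ?i 1"
    by (auto simp: vec_eq_iff grad_table_Suc axis_def)
  then have "transpose X *v grad_table idx (Suc t) = transpose X *v grad_table idx t +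
      (grad_table idx (Suc t) $ ?i - grad_table idx t $ ?i) *\<^sub>R (X $ ?i)"
    by (metis matrix_vector_right_distrib matrix_vector_mult_scaleR matrix_vector_mult_basis
        column_transpose row_def vec_nth_inverse)
  with Suc show ?case
    by (simp add: grad_table_def Let_def split: prod.splits)
qed (simp add: grad_table_def)

lemma iter_Suc:
  "iter idx (Suc t) = iter idx t +
    step_size (Suc t) *\<^sub>R (LMO (transpose X *v grad_table idx (Suc t)) - iter idx t)"
  unfolding residual_eq[symmetric]
  by (simp add: sfw_iterate_def step_size_def Let_def split: prod.split)

lemma iter_in_C: "iter idx t \<in> C"
proof (induction t)
  case (Suc t)
  let ?s = "LMO (transpose X *v grad_table idx (Suc t))"
  have "iter idx (Suc t) = (1 - step_size (Suc t)) *\<^sub>R iter idx t + step_size (Suc t) *\<^sub>R ?s"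
    by (simp add: iter_Suc algebra_simps)
  then show ?case
    using convexD_alt[OF convex_C Suc LMO_in_C, of "step_size (Suc t)"]
      step_size_nonneg step_size_le_1 by simp
qed (simp add: iter_0 w0_in_C)

lemma fw_gap_eq:
  "fw_gap C X f w = (SUP s\<in>C. \<Sum>i\<in>UNIV. partial_grad w i * (X $ i \<bullet> (w - s)))"
  by (simp add: fw_gap_def gradient_objective[OF smooth] inner_vec_def partial_grad_def
      matrix_vector_mul_component)

lemma fw_gap_nonneg:
  assumes "w \<in> C"
  shows "0 \<le> fw_gap C X f w"
proof -
  let ?F = "\<lambda>s. \<Sum>i\<in>UNIV. partial_grad w i * (X $ i \<bullet> (w - s))"
  have "?F s \<le> (\<Sum>i\<in>UNIV. \<bar>partial_grad w i\<bar> * width)" if "s \<in> C" for s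
    by (intro sum_mono mult_le_abs_mult inner_diff_le_width assms that)
  then have "?F w \<le> fw_gap C X f w"
    unfolding fw_gap_eq by (intro cSUP_upper[OF assms] bdd_aboveI2)
  then show ?thesis by simp
qed

text \<open>
  For \<open>s \<in> C\<close> and the oracle answer \<open>s'\<close>, write the gradient \<open>G\<close> as \<open>a + (G - a)\<close> in the term
  \<open>\<langle>G, X (s' - s)\<rangle>\<close>: the first part is nonpositive since \<open>s'\<close> is optimal for \<open>a\<close>, and the second one
  is controlled by the error of \<open>a\<close>. The bound is uniform in \<open>s\<close>, so it passes to the supremum.
\<close>

lemma fw_gap_le_LMO_decrease:
  fixes a :: "real ^ 'n"
  assumes "w \<in> C"
  defines "s' \<equiv> LMO (transpose X *v a)"
  shows "fw_gap C X f w \<le> - (\<Sum>i\<in>UNIV. partial_grad w i * (X $ i \<bullet> (s' - w)))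
    + width * (\<Sum>i\<in>UNIV. \<bar>partial_grad w i - a $ i\<bar>)"
  unfolding fw_gap_eq
proof (rule cSUP_least)
  show "C \<noteq> {}" using w0_in_C by blast
  fix s assume s: "s \<in> C"
  have inner_table: "v \<bullet> (transpose X *v a) = (\<Sum>i\<in>UNIV. a $ i * (X $ i \<bullet> v))" for v
  proof -
    have "v \<bullet> (transpose X *v a) = a \<bullet> (X *v v)"
      by (simp add: dot_lmul_matrix[symmetric] inner_commute)
    then show ?thesis by (simp add: inner_vec_def[of a] matrix_vector_mul_component)
  qed
  have "(\<Sum>i\<in>UNIV. a $ i * (X $ i \<bullet> (s' - s))) \<le> 0"
    using LMO_le[OF s, of "transpose X *v a"]
    unfolding s'_def inner_table by (simp add: inner_diff_right right_diff_distrib sum_subtractf)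
  moreover have "(\<Sum>i\<in>UNIV. (partial_grad w i - a $ i) * (X $ i \<bullet> (s' - s)))
      \<le> (\<Sum>i\<in>UNIV. \<bar>partial_grad w i - a $ i\<bar> * width)"
    unfolding s'_def by (intro sum_mono mult_le_abs_mult inner_diff_le_width LMO_in_C s)
  moreover have "(\<Sum>i\<in>UNIV. partial_grad w i * (X $ i \<bullet> (w - s)))
      = - (\<Sum>i\<in>UNIV. partial_grad w i * (X $ i \<bullet> (s' - w)))
        + ((\<Sum>i\<in>UNIV. a $ i * (X $ i \<bullet> (s' - s)))
        + (\<Sum>i\<in>UNIV. (partial_grad w i - a $ i) * (X $ i \<bullet> (s' - s))))"
    unfolding sum.distrib[symmetric] sum_negf[symmetric]
    by (intro sum.cong refl) (simp add: inner_diff_right algebra_simps)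
  ultimately show "(\<Sum>i\<in>UNIV. partial_grad w i * (X $ i \<bullet> (w - s)))
      \<le> - (\<Sum>i\<in>UNIV. partial_grad w i * (X $ i \<bullet> (s' - w)))
        + width * (\<Sum>i\<in>UNIV. \<bar>partial_grad w i - a $ i\<bar>)"
    by (simp add: sum_distrib_right[symmetric] mult.commute[of width])
qed

text \<open>
  The quadratic upper bound is applied coordinatewise, then the linear term is compared with
  the gap. The error terms are grouped so that they form the sequence \<open>c\<close> of
  \<open>summable_of_descent\<close>.
\<close>

lemma objective_descent:
  assumes w: "w \<in> C" and \<eta>: "0 \<le> \<eta>"
  shows "objective f (X *v (w + \<eta> *\<^sub>R (LMO (transpose X *v a) - w)))
    \<le> objective f (X *v w) - \<eta> * fw_gap C X f w
      + (width * (\<eta> * (\<Sum>i\<in>UNIV. \<bar>partial_grad w i - a $ i\<bar>)) + L * width\<^sup>2 * \<eta>\<^sup>2)"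
proof -
  define s where "s = LMO (transpose X *v a)"
  let ?n = "real CARD('n)"
  have "f i (X $ i \<bullet> (w + \<eta> *\<^sub>R (s - w)))
      \<le> f i (X $ i \<bullet> w) + deriv (f i) (X $ i \<bullet> w) * (\<eta> * (X $ i \<bullet> (s - w))) + L * width\<^sup>2 * \<eta>\<^sup>2" for i
  proof -
    have "f i (X $ i \<bullet> (w + \<eta> *\<^sub>R (s - w))) \<le> f i (X $ i \<bullet> w)
        + deriv (f i) (X $ i \<bullet> w) * (\<eta> * (X $ i \<bullet> (s - w))) + L * (\<eta> * (X $ i \<bullet> (s - w)))\<^sup>2"
      using L_smooth_upper_bound[OF smooth[of i], of "X $ i \<bullet> (w + \<eta> *\<^sub>R (s - w))" "X $ i \<bullet> w"]
      by (simp add: inner_add_right)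
    moreover have "(X $ i \<bullet> (s - w))\<^sup>2 \<le> width\<^sup>2"
      using inner_diff_le_width[OF LMO_in_C w] width_nonneg
      by (auto simp: s_def intro: abs_le_square_iff[THEN iffD1])
    then have "L * (\<eta> * (X $ i \<bullet> (s - w)))\<^sup>2 \<le> L * (\<eta>\<^sup>2 * width\<^sup>2)"
      using L_smooth_nonneg[OF smooth] by (simp add: power_mult_distrib mult_left_mono)
    ultimately show ?thesis by (simp add: mult_ac)
  qed
  then have "(\<Sum>i\<in>UNIV. f i (X $ i \<bullet> (w + \<eta> *\<^sub>R (s - w)))) \<le> (\<Sum>i\<in>UNIV. f i (X $ i \<bullet> w)
      + deriv (f i) (X $ i \<bullet> w) * (\<eta> * (X $ i \<bullet> (s - w))) + L * width\<^sup>2 * \<eta>\<^sup>2)"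
    by (intro sum_mono)
  then have "objective f (X *v (w + \<eta> *\<^sub>R (s - w))) \<le> (1 / ?n) * (\<Sum>i\<in>UNIV. f i (X $ i \<bullet> w)
      + deriv (f i) (X $ i \<bullet> w) * (\<eta> * (X $ i \<bullet> (s - w))) + L * width\<^sup>2 * \<eta>\<^sup>2)"
    unfolding objective_def matrix_vector_mul_component by (intro mult_left_mono) auto
  also have "\<dots> = objective f (X *v w)
      + \<eta> * (\<Sum>i\<in>UNIV. partial_grad w i * (X $ i \<bullet> (s - w))) + L * width\<^sup>2 * \<eta>\<^sup>2"
    by (simp add: objective_def matrix_vector_mul_component partial_grad_def sum.distrib
        sum_distrib_left distrib_left mult_ac)
  also have "\<dots> \<le> objective f (X *v w) + \<eta> * (- fw_gap C X f w
      + width * (\<Sum>i\<in>UNIV. \<bar>partial_grad w i - a $ i\<bar>)) + L * width\<^sup>2 * \<eta>\<^sup>2"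
    using fw_gap_le_LMO_decrease[OF w, of a] \<eta>
    by (intro add_right_mono add_left_mono mult_left_mono) (auto simp: s_def)
  finally show ?thesis
    by (simp add: s_def algebra_simps)
qed

lemma objective_bounded_below: "\<exists>m. \<forall>w\<in>C. m \<le> objective f (X *v w)"
proof -
  have "continuous_on UNIV (f i)" for i
    using DERIV_isCont[OF L_smooth_DERIV[OF smooth]] by (simp add: continuous_at_imp_continuous_on)
  then have "continuous_on C (\<lambda>w. f i (X $ i \<bullet> w))" for i
    by (rule continuous_on_compose2) (auto intro!: continuous_intros)
  then have "continuous_on C (\<lambda>w. objective f (X *v w))"
    unfolding objective_def matrix_vector_mul_component by (intro continuous_intros)
  then show ?thesis
    using continuous_attains_inf[OF compact_C] w0_in_C by blast
qed

text \<open>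
  Iteration \<open>t + 1\<close> first refreshes the sampled entry and only then calls the oracle, so the error
  that enters the descent is the staleness of the entries that were missed.
\<close>

lemma liminf_gap_of_summable_table_error:
  assumes "\<And>i. summable (\<lambda>t. step_size (Suc t) * (of_bool (idx (Suc t) \<noteq> i) * staleness idx t i))"
  shows "liminf (\<lambda>t. ereal (fw_gap C X f (iter idx t))) = 0"
proof -
  let ?err = "\<lambda>t. \<Sum>i\<in>UNIV. of_bool (idx (Suc t) \<noteq> i) * staleness idx t i"
  let ?c = "\<lambda>t. width * (step_size (Suc t) * ?err t) + L * width\<^sup>2 * (step_size (Suc t))\<^sup>2"
  obtain m where m: "\<And>w. w \<in> C \<Longrightarrow> m \<le> objective f (X *v w)"
    using objective_bounded_below by blast
  have err: "(\<Sum>i\<in>UNIV. \<bar>partial_grad (iter idx t) i - grad_table idx (Suc t) $ i\<bar>) = ?err t" for t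
    by (intro sum.cong) (auto simp: grad_table_Suc staleness_def)
  have "summable (\<lambda>t. step_size (Suc t) * fw_gap C X f (iter idx t))"
  proof (rule summable_of_descent[where a = "\<lambda>t. objective f (X *v iter idx t)" and c = ?c])
    show "objective f (X *v iter idx (Suc t)) \<le> objective f (X *v iter idx t)
        - step_size (Suc t) * fw_gap C X f (iter idx t) + ?c t" for t
      using objective_descent[OF iter_in_C step_size_nonneg, of idx t "Suc t" "grad_table idx (Suc t)"]
      unfolding err iter_Suc .
    show "summable ?c"
    proof (intro summable_add summable_mult)
      show "summable (\<lambda>t. step_size (Suc t) * ?err t)"
        unfolding sum_distrib_left by (intro summable_sum assms)
      show "summable (\<lambda>t. (step_size (Suc t))\<^sup>2)"
        using summable_step_size_square by (subst summable_Suc_iff)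
    qed
    show "0 \<le> ?c t" for t
      using L_smooth_nonneg[OF smooth] width_nonneg step_size_nonneg
      by (intro add_nonneg_nonneg mult_nonneg_nonneg sum_nonneg) (auto simp: staleness_def)
  qed (auto intro!: m iter_in_C mult_nonneg_nonneg step_size_nonneg fw_gap_nonneg)
  then show ?thesis
    by (rule liminf_eq_0_of_summable_weighted[OF fw_gap_nonneg[OF iter_in_C] step_size_nonneg
          not_summable_step_size])
qed

text \<open>
  A refreshed entry is exact at the old iterate; the move to the new iterate is \<open>step_size\<close> times
  a difference of two points of \<open>C\<close>, which alters the partial derivative by at most
  \<open>L * width * step_size\<close>.
\<close>

lemma staleness_Suc:
  "staleness idx (Suc t) i
    \<le> of_bool (idx (Suc t) \<noteq> i) * staleness idx t i + L * width * step_size (Suc t)"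
proof -
  define s where "s = LMO (transpose X *v grad_table idx (Suc t))"
  have "X $ i \<bullet> (iter idx (Suc t) - iter idx t) = step_size (Suc t) * (X $ i \<bullet> (s - iter idx t))"
    by (simp add: iter_Suc s_def)
  then have "L * \<bar>X $ i \<bullet> (iter idx (Suc t) - iter idx t)\<bar> \<le> L * (step_size (Suc t) * width)"
    using inner_diff_le_width[OF LMO_in_C iter_in_C] L_smooth_nonneg[OF smooth] step_size_nonneg[of "Suc t"]
    by (simp add: s_def abs_mult mult_left_mono)
  then have "\<bar>partial_grad (iter idx (Suc t)) i - partial_grad (iter idx t) i\<bar>
      \<le> L * width * step_size (Suc t)"
    using partial_grad_lipschitz[of "iter idx (Suc t)" i "iter idx t"] by (simp add: mult_ac)
  moreover have "\<bar>partial_grad (iter idx t) i - grad_table idx (Suc t) $ i\<bar>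
      = of_bool (idx (Suc t) \<noteq> i) * staleness idx t i"
    by (simp add: staleness_def grad_table_Suc)
  ultimately show ?thesis
    unfolding staleness_def[of idx "Suc t"] by linarith
qed

lemma sfw_state_cong:
  assumes "\<And>k. k \<in> {1..<Suc t} \<Longrightarrow> idx k = idx' k"
  shows "sfw_state X f LMO w0 \<alpha>0 idx t = sfw_state X f LMO w0 \<alpha>0 idx' t"
  using assms by (induction t) auto

text \<open>
  The past at time \<open>Suc t\<close> consists of the indices \<open>1, \<dots>, t\<close>, which are those used by the first
  \<open>t\<close> iterations. Both quantities are thus functions of a single random element with finitely many
  values, which settles all questions of measurability and integrability.
\<close>

lemma iter_past_indices: "iter (past_indices I (Suc t) \<omega>) t = iter (\<lambda>k. I k \<omega>) t"
  and staleness_past_indices: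
    "staleness (past_indices I (Suc t) \<omega>) t i = staleness (\<lambda>k. I k \<omega>) t i"
proof -
  have "sfw_state X f LMO w0 \<alpha>0 (past_indices I (Suc t) \<omega>) t
      = sfw_state X f LMO w0 \<alpha>0 (\<lambda>k. I k \<omega>) t"
    by (rule sfw_state_cong) (simp add: past_indices_def)
  then show "iter (past_indices I (Suc t) \<omega>) t = iter (\<lambda>k. I k \<omega>) t"
    and "staleness (past_indices I (Suc t) \<omega>) t i = staleness (\<lambda>k. I k \<omega>) t i"
    by (simp_all add: sfw_iterate_def staleness_def grad_table_def)
qed

end

section \<open>Random variables that depend on the sampled indices\<close>

lemma AE_summable_of_summable_integral:
  fixes Z :: "nat \<Rightarrow> 'a \<Rightarrow> real"
  assumes "\<And>n. integrable M (Z n)" and "\<And>n \<omega>. 0 \<le> Z n \<omega>"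
    and "summable (\<lambda>n. \<integral>\<omega>. Z n \<omega> \<partial>M)"
  shows "AE \<omega> in M. summable (\<lambda>n. Z n \<omega>)"
proof -
  have [measurable]: "Z n \<in> borel_measurable M" for n
    using assms(1) by blast
  have "(\<integral>\<^sup>+\<omega>. (\<Sum>n. ennreal (Z n \<omega>)) \<partial>M) = (\<Sum>n. \<integral>\<^sup>+\<omega>. ennreal (Z n \<omega>) \<partial>M)"
    by (intro nn_integral_suminf) measurable
  also have "\<dots> = (\<Sum>n. ennreal (\<integral>\<omega>. Z n \<omega> \<partial>M))"
    using assms by (simp add: nn_integral_eq_integral)
  also have "\<dots> = ennreal (\<Sum>n. \<integral>\<omega>. Z n \<omega> \<partial>M)"
    using assms by (intro suminf_ennreal2) auto
  finally have "AE \<omega> in M. (\<Sum>n. ennreal (Z n \<omega>)) \<noteq> \<infinity>"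
    by (intro nn_integral_PInf_AE) auto
  then show ?thesis
    by eventually_elim (use assms(2) in \<open>auto intro: summable_suminf_not_top\<close>)
qed

lemma subalgebra_vimage_algebra:
  assumes "h \<in> measurable M N"
  shows "subalgebra M (vimage_algebra (space M) h N)"
proof -
  have "sets (vimage_algebra (space M) h N) \<subseteq> sets M"
    unfolding sets_vimage_algebra using assms
    by (intro sets.sigma_sets_subset) (auto dest: measurable_sets)
  then show ?thesis
    by (simp add: subalgebra_def)
qed

text \<open>
  Independence of two random variables requires a common value type, which the sampled index
  and the tuple of past indices do not share. Functions of them to the reals do, and they inherit
  independence from the subalgebras with respect to which they are measurable.
\<close>

lemma (in prob_space) indep_var_of_indep_subalgebras:
  assumes "indep_set (sets F) (sets G)" and "subalgebra M F" and "subalgebra M G"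
    and "Y \<in> measurable F N" and "Z \<in> measurable G N'"
  shows "indep_var N Y N' Z"
proof -
  have preimages: "sigma_sets (space M) {h -` A \<inter> space M | A. A \<in> sets N''} \<subseteq> sets H"
    if "subalgebra M H" "h \<in> measurable H N''" for h :: "'a \<Rightarrow> 'b" and H N''
  proof -
    have "space H = space M"
      using that(1) by (simp add: subalgebra_def)
    moreover have "{h -` A \<inter> space H | A. A \<in> sets N''} \<subseteq> sets H"
      using that(2) by (auto dest: measurable_sets)
    then have "sigma_sets (space H) {h -` A \<inter> space H | A. A \<in> sets N''} \<subseteq> sets H"
      by (rule sets.sigma_sets_subset)
    ultimately show ?thesis
      by simp
  qed
  show ?thesis
    unfolding indep_var_eq
  proof (intro conjI)
    show "indep_set (sigma_sets (space M) {Y -` A \<inter> space M | A. A \<in> sets N})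
        (sigma_sets (space M) {Z -` A \<inter> space M | A. A \<in> sets N'})"
      using assms(1) preimages[OF assms(2,4)] preimages[OF assms(3,5)] unfolding indep_set_def
      by (elim indep_sets_mono_sets) (auto split: bool.split)
  qed (use assms in \<open>auto intro: measurable_from_subalg\<close>)
qed

lemma past_space_eq:
  "(past_space t :: (nat \<Rightarrow> 'n::finite) measure) = count_space (PiE {1..<t} (\<lambda>_. UNIV))"
  unfolding past_space_def by (intro count_space_PiM_finite) (auto intro: countable_finite)

lemma past_indices_in_space: "past_indices I t \<omega> \<in> PiE {1..<t} (\<lambda>_. UNIV)"
  by (simp add: past_indices_def)

locale uniform_sampling_space = prob_space M
  for M :: "'a measure" and I :: "nat \<Rightarrow> 'a \<Rightarrow> 'n::finite" +
  assumes sampling: "uniform_sampling M I"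
begin

lemma measurable_index: "1 \<le> t \<Longrightarrow> I t \<in> measurable M (count_space UNIV)"
  using sampling by (simp add: uniform_sampling_def)

lemma measurable_past_indices: "past_indices I t \<in> measurable M (past_space t)"
  unfolding past_indices_def[abs_def] past_space_def
  by (intro measurable_restrict measurable_index) simp

text \<open>
  The space of past indices is finite and discrete, so every function on it is measurable,
  including one that is built from an arbitrary oracle.
\<close>

lemma measurable_fun_past:
  "(\<lambda>\<omega>. \<phi> (past_indices I t \<omega>) :: real) \<in> borel_measurable (past_algebra M I t)"
proof -
  have "past_indices I t \<in> measurable (past_algebra M I t) (past_space t)"
    unfolding past_algebra_def past_space_eq
    by (intro measurable_vimage_algebra1, unfold space_count_space) (rule Pi_I, rule past_indices_in_space)
  moreover have "\<phi> \<in> borel_measurable (past_space t)"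
    by (simp add: past_space_eq)
  ultimately show ?thesis
    by (rule measurable_compose)
qed

lemma subalgebra_past_algebra: "subalgebra M (past_algebra M I t)"
  unfolding past_algebra_def by (rule subalgebra_vimage_algebra[OF measurable_past_indices])

lemma integrable_fun_past: "integrable M (\<lambda>\<omega>. \<phi> (past_indices I t \<omega>) :: real)"
proof -
  let ?P = "PiE {1..<t} (\<lambda>_. UNIV :: 'n set)"
  have "finite ?P" by (intro finite_PiE) auto
  then have "norm (\<phi> (past_indices I t \<omega>)) \<le> (\<Sum>p\<in>?P. \<bar>\<phi> p\<bar>)" for \<omega>
    using member_le_sum[OF past_indices_in_space[of I t \<omega>], of "\<lambda>p. \<bar>\<phi> p\<bar>"] by simp
  then show ?thesis
    by (intro integrable_const_bound AE_I2)
      (auto intro: measurable_from_subalg[OF subalgebra_past_algebra measurable_fun_past])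
qed

lemma real_cond_exp_fun_past:
  "AE \<omega> in M. real_cond_exp M (past_algebra M I t) (\<lambda>\<omega>. \<phi> (past_indices I t \<omega>)) \<omega>
    = \<phi> (past_indices I t \<omega>)"
proof -
  interpret sigma_finite_subalgebra M "past_algebra M I t"
    by (intro finite_measure_subalgebra_is_sigma_finite finite_measure_subalgebra.intro
        finite_measure_subalgebra_axioms.intro subalgebra_past_algebra finite_measure_axioms)
  show ?thesis
    by (intro real_cond_exp_F_meas integrable_fun_past measurable_fun_past)
qed

lemma expectation_index_miss:
  assumes "1 \<le> t"
  shows "expectation (\<lambda>\<omega>. of_bool (I t \<omega> \<noteq> i) :: real) = 1 - 1 / real CARD('n)"
proof -
  have "expectation (\<lambda>\<omega>. of_bool (I t \<omega> \<noteq> i) :: real)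
      = (\<integral>j. of_bool (j \<noteq> i) \<partial>distr M (count_space UNIV) (I t))"
    using measurable_index[OF assms] by (subst integral_distr) auto
  also have "\<dots> = (\<integral>j. of_bool (j \<noteq> i) \<partial>uniform_count_measure (UNIV :: 'n set))"
    using sampling assms by (simp add: uniform_sampling_def)
  also have "\<dots> = (\<Sum>j\<in>UNIV. of_bool (j \<noteq> i)) / real CARD('n)"
    by (subst integral_uniform_count_measure) auto
  also have "(\<Sum>j\<in>UNIV. of_bool (j \<noteq> i) :: real) = real CARD('n) - 1"
  proof -
    have "{j. j \<noteq> i} = UNIV - {i}"
      by auto
    then show ?thesis
      by (simp add: card_Diff_singleton of_nat_diff Suc_leI)
  qed
  finally show ?thesis by (simp add: diff_divide_distrib)
qed

lemma integrable_miss_fun_past: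
    "1 \<le> t \<Longrightarrow> integrable M (\<lambda>\<omega>. of_bool (I t \<omega> \<noteq> i) * (\<phi> (past_indices I t \<omega>) :: real))"
  and expectation_miss_fun_past:
    "1 \<le> t \<Longrightarrow> expectation (\<lambda>\<omega>. of_bool (I t \<omega> \<noteq> i) * \<phi> (past_indices I t \<omega>))
      = (1 - 1 / real CARD('n)) * expectation (\<lambda>\<omega>. \<phi> (past_indices I t \<omega>))"
proof -
  assume t: "1 \<le> t"
  let ?F = "vimage_algebra (space M) (I t) (count_space UNIV)"
  let ?miss = "\<lambda>\<omega>. of_bool (I t \<omega> \<noteq> i) :: real"
  have F: "subalgebra M ?F"
    by (intro subalgebra_vimage_algebra measurable_index t)
  have miss: "?miss \<in> borel_measurable ?F"
    by (rule measurable_compose[OF measurable_vimage_algebra1]) auto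
  have "indep_set (sets ?F) (sets (past_algebra M I t))"
    using sampling t by (simp add: uniform_sampling_def)
  then have indep: "indep_var borel ?miss borel (\<lambda>\<omega>. \<phi> (past_indices I t \<omega>))"
    using F subalgebra_past_algebra miss measurable_fun_past by (rule indep_var_of_indep_subalgebras)
  have int: "integrable M ?miss"
    using measurable_from_subalg[OF F miss] by (intro integrable_const_bound[where B = 1]) auto
  show "integrable M (\<lambda>\<omega>. of_bool (I t \<omega> \<noteq> i) * (\<phi> (past_indices I t \<omega>) :: real))"
    using indep_var_integrable[OF indep int] integrable_fun_past by simp
  show "expectation (\<lambda>\<omega>. of_bool (I t \<omega> \<noteq> i) * \<phi> (past_indices I t \<omega>))
      = (1 - 1 / real CARD('n)) * expectation (\<lambda>\<omega>. \<phi> (past_indices I t \<omega>))"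
    using indep_var_lebesgue_integral[OF indep int] integrable_fun_past
    by (simp add: expectation_index_miss[OF t])
qed

end

section \<open>The table error of the random trajectory\<close>

locale stochastic_frank_wolfe =
  frank_wolfe C X f L LMO w0 \<alpha>0 + uniform_sampling_space M I
  for C :: "(real ^ 'd) set" and X :: "real ^ 'd ^ 'n::finite" and f L LMO w0 \<alpha>0
    and M :: "'a measure" and I :: "nat \<Rightarrow> 'a \<Rightarrow> 'n"
begin

abbreviation index_path :: "'a \<Rightarrow> nat \<Rightarrow> 'n" where
  "index_path \<omega> \<equiv> \<lambda>k. I k \<omega>"

lemma integrable_staleness: "integrable M (\<lambda>\<omega>. staleness (index_path \<omega>) t i)"
  using integrable_fun_past[of "\<lambda>p. staleness p t i" "Suc t"] by (simp add: staleness_past_indices)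

lemma integrable_miss_staleness:
  "integrable M (\<lambda>\<omega>. of_bool (I (Suc t) \<omega> \<noteq> i) * staleness (index_path \<omega>) t i)"
  using integrable_miss_fun_past[of "Suc t" i "\<lambda>p. staleness p t i"]
  unfolding staleness_past_indices by simp

lemma expectation_miss_staleness:
  "expectation (\<lambda>\<omega>. of_bool (I (Suc t) \<omega> \<noteq> i) * staleness (index_path \<omega>) t i)
    = (1 - 1 / real CARD('n)) * expectation (\<lambda>\<omega>. staleness (index_path \<omega>) t i)"
  using expectation_miss_fun_past[of "Suc t" i "\<lambda>p. staleness p t i"]
  unfolding staleness_past_indices by linarith

lemma expectation_staleness_Suc:
  "expectation (\<lambda>\<omega>. staleness (index_path \<omega>) (Suc t) i)
    \<le> (1 - 1 / real CARD('n)) * expectation (\<lambda>\<omega>. staleness (index_path \<omega>) t i)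
      + L * width * step_size (Suc t)"
proof -
  have "expectation (\<lambda>\<omega>. staleness (index_path \<omega>) (Suc t) i)
      \<le> expectation (\<lambda>\<omega>. of_bool (I (Suc t) \<omega> \<noteq> i) * staleness (index_path \<omega>) t i
        + L * width * step_size (Suc t))"
    by (intro integral_mono staleness_Suc integrable_staleness Bochner_Integration.integrable_add
        integrable_miss_staleness integrable_const)
  then show ?thesis
    by (simp add: expectation_miss_staleness integrable_miss_staleness prob_space)
qed

text \<open>
  The step sizes decrease, so the contraction of the expected staleness is inherited by its
  product with the step size, where the perturbation becomes summable.
\<close>

lemma summable_expectation_staleness:
  "summable (\<lambda>t. step_size t * expectation (\<lambda>\<omega>. staleness (index_path \<omega>) t i))"
proof -
  let ?u = "\<lambda>t. expectation (\<lambda>\<omega>. staleness (index_path \<omega>) t i)"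
  let ?b = "\<lambda>t. L * width * (step_size (Suc t))\<^sup>2"
  define \<rho> where "\<rho> = 1 - 1 / real CARD('n)"
  have u: "0 \<le> ?u t" for t
    by (intro integral_nonneg_AE AE_I2 staleness_nonneg)
  have \<rho>: "0 \<le> \<rho>" "\<rho> < 1"
    by (simp_all add: \<rho>_def field_simps Suc_leI)
  show ?thesis
  proof (rule summable_of_contraction[OF _ _ _ \<rho>(2)])
    show "0 \<le> step_size t * ?u t" for t
      using u step_size_nonneg by simp
    show "0 \<le> ?b t" for t
      using L_smooth_nonneg[OF smooth] width_nonneg by simp
    show "summable ?b"
      using summable_step_size_square by (intro summable_mult) (subst summable_Suc_iff)
    show "step_size (Suc t) * ?u (Suc t) \<le> \<rho> * (step_size t * ?u t) + ?b t" for t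
    proof -
      have "step_size (Suc t) * ?u (Suc t)
          \<le> step_size (Suc t) * (\<rho> * ?u t + L * width * step_size (Suc t))"
        unfolding \<rho>_def by (intro mult_left_mono expectation_staleness_Suc step_size_nonneg)
      also have "\<dots> = step_size (Suc t) * (\<rho> * ?u t) + ?b t"
        by (simp add: distrib_left power2_eq_square mult_ac)
      also have "\<dots> \<le> step_size t * (\<rho> * ?u t) + ?b t"
        using \<rho>(1) u by (intro add_right_mono mult_right_mono step_size_antimono mult_nonneg_nonneg)
      finally show ?thesis by (simp add: mult_ac)
    qed
  qed
qed

lemma AE_summable_table_error:
  "AE \<omega> in M. summable (\<lambda>t. step_size (Suc t) *
    (of_bool (I (Suc t) \<omega> \<noteq> i) * staleness (index_path \<omega>) t i))"
proof (rule AE_summable_of_summable_integral)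
  let ?u = "\<lambda>t. expectation (\<lambda>\<omega>. staleness (index_path \<omega>) t i)"
  define \<rho> where "\<rho> = 1 - 1 / real CARD('n)"
  have u: "0 \<le> ?u t" for t
    by (intro integral_nonneg_AE AE_I2 staleness_nonneg)
  have \<rho>: "0 \<le> \<rho>"
    by (simp add: \<rho>_def field_simps Suc_leI)
  \<comment> \<open>Iteration \<open>t + 1\<close> weights the staleness at time \<open>t\<close> with the smaller step \<open>t + 1\<close>.\<close>
  have "step_size (Suc t) * (\<rho> * ?u t) \<le> step_size t * (\<rho> * ?u t)" for t
    using \<rho> u by (intro mult_right_mono step_size_antimono mult_nonneg_nonneg)
  then have bound: "norm (step_size (Suc t) * (\<rho> * ?u t)) \<le> \<rho> * (step_size t * ?u t)" for t
    using \<rho> u step_size_nonneg by (simp add: abs_mult mult_ac)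
  have "summable (\<lambda>t. step_size (Suc t) * (\<rho> * ?u t))"
    by (rule summable_comparison_test'[OF summable_mult[OF summable_expectation_staleness] bound])
  then show "summable (\<lambda>t. expectation (\<lambda>\<omega>. step_size (Suc t) *
      (of_bool (I (Suc t) \<omega> \<noteq> i) * staleness (index_path \<omega>) t i)))"
    by (simp add: expectation_miss_staleness \<rho>_def)
qed (auto intro!: integrable_mult_right integrable_miss_staleness mult_nonneg_nonneg
      step_size_nonneg staleness_nonneg)

lemma AE_liminf_gap: "AE \<omega> in M. liminf (\<lambda>t. ereal (fw_gap C X f (iter (index_path \<omega>) t))) = 0"
proof -
  have "AE \<omega> in M. \<forall>i. summable (\<lambda>t. step_size (Suc t) *
      (of_bool (I (Suc t) \<omega> \<noteq> i) * staleness (index_path \<omega>) t i))"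
    using AE_summable_table_error by (simp add: AE_all_countable)
  then show ?thesis
    by eventually_elim (rule liminf_gap_of_summable_table_error, blast)
qed

lemma AE_real_cond_exp_gap:
  "AE \<omega> in M. \<forall>t. real_cond_exp M (past_algebra M I (Suc t))
      (\<lambda>\<omega>. fw_gap C X f (iter (index_path \<omega>) t)) \<omega> = fw_gap C X f (iter (index_path \<omega>) t)"
proof -
  have "AE \<omega> in M. real_cond_exp M (past_algebra M I (Suc t))
      (\<lambda>\<omega>. fw_gap C X f (iter (index_path \<omega>) t)) \<omega> = fw_gap C X f (iter (index_path \<omega>) t)" for t
    using real_cond_exp_fun_past[of "Suc t" "\<lambda>p. fw_gap C X f (iter p t)"]
    by (simp add: iter_past_indices)
  then show ?thesis
    by (simp add: AE_all_countable)
qed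

end

theorem theorem2:
  fixes M :: "'a measure"
    and I :: "nat \<Rightarrow> 'a \<Rightarrow> 'n::finite"
    and C :: "(real ^ 'd) set"
    and X :: "real ^ 'd ^ 'n"
    and f :: "'n \<Rightarrow> real \<Rightarrow> real"
    and L :: real
    and LMO :: "real ^ 'd \<Rightarrow> real ^ 'd"
    and w0 :: "real ^ 'd"
    and \<alpha>0 :: "real ^ 'n"
    and g :: "nat \<Rightarrow> 'a \<Rightarrow> real"
  assumes "C \<noteq> {}" and "compact C" and "convex C"
    and "\<And>i. L_smooth L (f i)"
    and "is_LMO C LMO"
    and "w0 \<in> C"
    and "prob_space M"
    and "uniform_sampling M I"
    and "\<And>t \<omega>. t \<ge> 1 \<Longrightarrow>
           g t \<omega> = fw_gap C X f (sfw_iterate X f LMO w0 \<alpha>0 (\<lambda>k. I k \<omega>) (t - 1))"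
  shows "AE \<omega> in M.
           liminf (\<lambda>t. ereal (real_cond_exp M (past_algebra M I t) (g t) \<omega>)) = 0"
proof -
  interpret stochastic_frank_wolfe C X f L LMO w0 \<alpha>0 M I
    by (intro stochastic_frank_wolfe.intro frank_wolfe.intro uniform_sampling_space.intro
        uniform_sampling_space_axioms.intro) (fact assms)+
  have g: "g (Suc t) = (\<lambda>\<omega>. fw_gap C X f (iter (index_path \<omega>) t))" for t
    using assms(9)[of "Suc t"] by auto
  show ?thesis
    using AE_liminf_gap AE_real_cond_exp_gap
  proof eventually_elim
    case (elim \<omega>)
    \<comment> \<open>Nothing is known about \<open>g 0\<close>, and the lower limit does not see it.\<close>
    have "liminf (\<lambda>t. ereal (real_cond_exp M (past_algebra M I (t + 1)) (g (t + 1)) \<omega>)) = 0"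
      using elim by (simp add: g)
    then show ?case
      by (simp only: liminf_shift[where u = "\<lambda>t. ereal (real_cond_exp M (past_algebra M I t) (g t) \<omega>)"])
  qed
qed

end
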